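(* Let $2<p<\infty$. Then there is a constant $c>0$ depending only on $p$ such that for every $f\in L^p(\mathrm{SU}(2))$, $$\sum_{l\in\frac12\mathbb{N}_0}(2l+1)^{p-2}\left(\sup_{\substack{k\in\frac12\mathbb{N}_0\\ k\geq l}}\frac1{2k+1}\left|\operatorname{Tr}\widehat f(k)\right|\right)^p\leq c\,\|f\|^p_{L^p(\mathrm{SU}(2))}.$$
   Context: $\mathrm{SU}(2)$ carries the normalized Haar measure $du$, and $\frac12\mathbb{N}_0=\{0,\frac12,1,\frac32,\dots\}$. For $l\in\frac12\mathbb{N}_0$, let $V_l$ be the $(2l+1)$-dimensional space of homogeneous polynomials of degree $2l$ in two complex variables $z=(z_1,z_2)$ (a row vector), and let $t^l$ be the irreducible representation $(t^l(u)P)(z)=P(zu)$ of $\mathrm{SU}(2)$ on $V_l$, written in a basis of $V_l$ making it a unitary matrix representation $t^l:\mathrm{SU}(2)\to \mathrm{U}(2l+1)$. Every irreducible unitary representation of $\mathrm{SU}(2)$ is equivalent to exactly one $t^l$. The Fourier coefficient of $f\in L^1(\mathrm{SU}(2))$ is the matrix $\widehat f(l)=\int_{\mathrm{SU}(2)}f(u)\,t^l(u)^*\,du\in\mathbb{C}^{(2l+1)\times(2l+1)}$, and $\operatorname{Tr}$ is the usual matrix trace. *)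

theory Defs
  imports "Jordan_Normal_Form.Schur_Decomposition" "HOL-Analysis.Analysis"
begin

text \<open>
  The group SU(2) lives in the fixed-size matrices \<open>complex ^ 2 ^ 2\<close>, which carry
  the topology; the representation matrices and Fourier coefficients, whose size varies with
  the spin, are matrices in the sense of \<^theory>\<open>Jordan_Normal_Form.Matrix\<close>.
\<close>

no_notation Matrix.vec_index (infixl "$" 100)

definition SU2 :: "(complex ^ 2 ^ 2) set" where
  "SU2 = {u. (\<chi> i j. cnj (u $ j $ i)) ** u = Finite_Cartesian_Product.mat 1
            \<and> Determinants.det u = 1}"

text \<open>
  SU(2) is a compact metrizable group, so a Borel probability measure on it is automatically
  Radon, and exactly one such measure is left invariant.
\<close>

definition normalized_haar_SU2 :: "(complex ^ 2 ^ 2) measure \<Rightarrow> bool" where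
  "normalized_haar_SU2 \<mu> \<longleftrightarrow>
     space \<mu> = SU2 \<and> sets \<mu> = sets (restrict_space borel SU2) \<and>
     emeasure \<mu> SU2 = 1 \<and>
     (\<forall>u\<in>SU2. \<forall>A\<in>sets \<mu>. emeasure \<mu> ((\<lambda>v. u ** v) ` A) = emeasure \<mu> A)"

definition half_nats :: "real set" where
  "half_nats = range (\<lambda>n::nat. real n / 2)"

text \<open>The natural number \<open>2 * l\<close>, for \<open>l \<in> half_nats\<close>.\<close>

definition spin_degree :: "real \<Rightarrow> nat" where
  "spin_degree l = nat \<lfloor>2 * l\<rfloor>"

abbreviation spin_dim :: "real \<Rightarrow> nat" where
  "spin_dim l \<equiv> spin_degree l + 1"

text \<open>Homogeneous polynomials of degree \<open>2 * l\<close>, as polynomial functions on row vectors.\<close>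

definition spin_space :: "real \<Rightarrow> (complex ^ 2 \<Rightarrow> complex) set" where
  "spin_space l =
     {P. \<exists>a. P = (\<lambda>z. \<Sum>j\<le>spin_degree l. a j * (z $ 1) ^ (spin_degree l - j) * (z $ 2) ^ j)}"

definition spin_action ::
    "complex ^ 2 ^ 2 \<Rightarrow> (complex ^ 2 \<Rightarrow> complex) \<Rightarrow> complex ^ 2 \<Rightarrow> complex" where
  "spin_action u P = (\<lambda>z. P (z v* u))"

definition is_basis_of ::
    "nat \<Rightarrow> (nat \<Rightarrow> 'b \<Rightarrow> complex) \<Rightarrow> ('b \<Rightarrow> complex) set \<Rightarrow> bool" where
  "is_basis_of d b V \<longleftrightarrow>
     (\<forall>j<d. b j \<in> V) \<and>
     (\<forall>P\<in>V. \<exists>a. P = (\<lambda>z. \<Sum>j<d. a j * b j z)) \<and>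
     (\<forall>a. (\<lambda>z. \<Sum>j<d. a j * b j z) = (\<lambda>z. 0) \<longrightarrow> (\<forall>j<d. a j = 0))"

text \<open>
  \<open>T\<close> is the representation of SU(2) on \<open>spin_space l\<close>, written as a unitary matrix
  representation in some basis. Column \<open>j\<close> of \<open>T u\<close> holds the coordinates of the
  image of the \<open>j\<close>-th basis vector. Values of \<open>T\<close> outside SU(2) are irrelevant.
\<close>

definition unitary_spin_rep :: "real \<Rightarrow> (complex ^ 2 ^ 2 \<Rightarrow> complex mat) \<Rightarrow> bool" where
  "unitary_spin_rep l T \<longleftrightarrow>
     (\<exists>b. is_basis_of (spin_dim l) b (spin_space l) \<and>
        (\<forall>u\<in>SU2.
           T u \<in> carrier_mat (spin_dim l) (spin_dim l) \<and>
           mat_adjoint (T u) * T u = 1\<^sub>m (spin_dim l) \<and>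
           (\<forall>j<spin_dim l.
              spin_action u (b j) = (\<lambda>z. \<Sum>i<spin_dim l. T u $$ (i, j) * b i z))))"

definition fourier_coeff ::
    "(complex ^ 2 ^ 2) measure \<Rightarrow> (real \<Rightarrow> complex ^ 2 ^ 2 \<Rightarrow> complex mat) \<Rightarrow>
     (complex ^ 2 ^ 2 \<Rightarrow> complex) \<Rightarrow> real \<Rightarrow> complex mat" where
  "fourier_coeff \<mu> t f l =
     Matrix.mat (spin_dim l) (spin_dim l)
       (\<lambda>(i, j). \<integral>u. f u * mat_adjoint (t l u) $$ (i, j) \<partial>\<mu>)"

definition mat_trace :: "complex mat \<Rightarrow> complex" where
  "mat_trace A = (\<Sum>i<dim_row A. A $$ (i, i))"

definition Lp_space :: "real \<Rightarrow> 'a measure \<Rightarrow> ('a \<Rightarrow> complex) set" where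
  "Lp_space p M = {f \<in> borel_measurable M. integrable M (\<lambda>x. norm (f x) powr p)}"

definition Lp_norm :: "real \<Rightarrow> 'a measure \<Rightarrow> ('a \<Rightarrow> complex) \<Rightarrow> real" where
  "Lp_norm p M f = (\<integral>x. norm (f x) powr p \<partial>M) powr (1 / p)"

text \<open>
  The supremum below is a real one, hence meaningful only where the family is bounded above.
\<close>

definition fourier_tail_sup ::
    "(complex ^ 2 ^ 2) measure \<Rightarrow> (real \<Rightarrow> complex ^ 2 ^ 2 \<Rightarrow> complex mat) \<Rightarrow>
     (complex ^ 2 ^ 2 \<Rightarrow> complex) \<Rightarrow> real \<Rightarrow> real" where
  "fourier_tail_sup \<mu> t f l =
     (SUP k\<in>{k\<in>half_nats. l \<le> k}. 1 / (2 * k + 1) * norm (mat_trace (fourier_coeff \<mu> t f k)))"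

end

theory Submission
  imports Defs
begin

text \<open>
  The trace of the Fourier coefficient is the pairing of \<open>f\<close> with the irreducible character
  of spin \<open>k\<close>, whose \<open>L\<^sup>2\<close> norm is 1. Since \<open>p > 2\<close>, the traces are bounded by a
  constant times the \<open>L\<^sup>p\<close> norm of \<open>f\<close>, uniformly in \<open>k\<close>, and the weighted sum is dominated by
  a multiple of \<open>\<Sum>l. (2 * l + 1) powr (- 2)\<close>.

  The norm of the character comes from the Clebsch-Gordan identity: the squared modulus of the
  character of degree \<open>n\<close> is the sum of the characters of degree \<open>2 * k\<close> for \<open>k \<le> n\<close>. The mean
  of a character of positive degree vanishes because averaging a homogeneous polynomial over
  SU(2) gives an invariant polynomial; transitivity on the sphere and the diagonal torus force it
  to be 0.
\<close>

section \<open>The group SU(2): coordinates, group structure and diagonalization\<close>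

lemma SU2_iff:
  "u \<in> SU2 \<longleftrightarrow> u $ 2 $ 2 = cnj (u $ 1 $ 1) \<and> u $ 1 $ 2 = - cnj (u $ 2 $ 1) \<and>
     (cmod (u $ 1 $ 1))\<^sup>2 + (cmod (u $ 2 $ 1))\<^sup>2 = 1"
proof -
  define a b c d where abcd: "a = u $ 1 $ 1" "b = u $ 1 $ 2" "c = u $ 2 $ 1" "d = u $ 2 $ 2"
  have "u \<in> SU2 \<longleftrightarrow> cnj a * a + cnj c * c = 1 \<and> cnj a * b + cnj c * d = 0 \<and>
      cnj b * a + cnj d * c = 0 \<and> cnj b * b + cnj d * d = 1 \<and> a * d - b * c = 1" (is "_ \<longleftrightarrow> ?E")
    by (auto simp: SU2_def vec_eq_iff forall_2 sum_2 matrix_matrix_mult_def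
        Finite_Cartesian_Product.mat_def Determinants.det_2 abcd)
  also have "?E \<longleftrightarrow> d = cnj a \<and> b = - cnj c \<and> cnj a * a + cnj c * c = 1"
  proof (intro iffI conjI; (elim conjE)?)
    assume *: "cnj a * a + cnj c * c = 1" "cnj a * b + cnj c * d = 0" "a * d - b * c = 1"
    \<comment> \<open>Cramer's rule: for given \<open>a\<close> and \<open>c\<close>, orthogonality
      of the columns and the determinant condition are two linear equations in \<open>b\<close> and
      \<open>d\<close>, with determinant \<open>cnj a * a + cnj c * c = 1\<close>.\<close>
    have "d = d * (cnj a * a + cnj c * c)" using * by simp
    also have "\<dots> = cnj a * (a * d - b * c) + c * (cnj a * b + cnj c * d)"
      by (simp add: algebra_simps)
    finally show "d = cnj a" using * by simp
    have "b = b * (cnj a * a + cnj c * c)" using * by simp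
    also have "\<dots> = a * (cnj a * b + cnj c * d) - cnj c * (a * d - b * c)"
      by (simp add: algebra_simps)
    finally show "b = - cnj c" using * by simp
  qed (auto simp: mult.commute add.commute)
  also have "cnj a * a + cnj c * c = 1 \<longleftrightarrow> (cmod a)\<^sup>2 + (cmod c)\<^sup>2 = 1"
  proof -
    have "cnj a * a + cnj c * c = of_real ((cmod a)\<^sup>2 + (cmod c)\<^sup>2)"
      by (simp add: complex_norm_square mult.commute del: of_real_power)
    thus ?thesis by (simp only: of_real_eq_1_iff)
  qed
  finally show ?thesis by (simp add: abcd)
qed

definition SU2_mat :: "complex \<Rightarrow> complex \<Rightarrow> complex ^ 2 ^ 2" where
  "SU2_mat a b = vector [vector [a, b], vector [- cnj b, cnj a]]"

lemma SU2_mat_nth [simp]: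
  "SU2_mat a b $ 1 $ 1 = a" "SU2_mat a b $ 1 $ 2 = b"
  "SU2_mat a b $ 2 $ 1 = - cnj b" "SU2_mat a b $ 2 $ 2 = cnj a"
  by (simp_all add: SU2_mat_def)

lemma SU2_mat_in_SU2: "(cmod a)\<^sup>2 + (cmod b)\<^sup>2 = 1 \<Longrightarrow> SU2_mat a b \<in> SU2"
  by (simp add: SU2_iff)

lemma SU2_norm_nth_le_1:
  assumes "u \<in> SU2"
  shows "cmod (u $ i $ j) \<le> 1"
proof -
  have "(cmod (u $ 1 $ 1))\<^sup>2 \<le> 1\<^sup>2" "(cmod (u $ 2 $ 1))\<^sup>2 \<le> 1\<^sup>2"
    using assms zero_le_power2[of "cmod (u $ 1 $ 1)"] zero_le_power2[of "cmod (u $ 2 $ 1)"]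
    unfolding SU2_iff one_power2 by linarith+
  hence "cmod (u $ 1 $ 1) \<le> 1" "cmod (u $ 2 $ 1) \<le> 1"
    by (auto intro: power2_le_imp_le)
  thus ?thesis
    using assms exhaust_2[of i] exhaust_2[of j] by (auto simp: SU2_iff)
qed

definition SU2_inv :: "complex ^ 2 ^ 2 \<Rightarrow> complex ^ 2 ^ 2" where
  "SU2_inv u = (\<chi> i j. cnj (u $ j $ i))"

lemma SU2_inv:
  assumes "u \<in> SU2"
  shows "SU2_inv u \<in> SU2" "SU2_inv u ** u = Finite_Cartesian_Product.mat 1"
    "u ** SU2_inv u = Finite_Cartesian_Product.mat 1"
proof -
  show 1: "SU2_inv u ** u = Finite_Cartesian_Product.mat 1"
    using assms by (simp add: SU2_def SU2_inv_def)
  thus "u ** SU2_inv u = Finite_Cartesian_Product.mat 1"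
    using matrix_left_right_inverse by blast
  show "SU2_inv u \<in> SU2"
    using assms by (simp add: SU2_iff SU2_inv_def)
qed

lemma SU2_mult:
  assumes "u \<in> SU2" "v \<in> SU2"
  shows "u ** v \<in> SU2"
proof -
  have "SU2_inv (u ** v) = SU2_inv v ** SU2_inv u"
    by (simp add: SU2_inv_def vec_eq_iff matrix_matrix_mult_def mult.commute)
  hence "SU2_inv (u ** v) ** (u ** v) = SU2_inv v ** (SU2_inv u ** u) ** v"
    by (simp only: matrix_mul_assoc)
  hence "SU2_inv (u ** v) ** (u ** v) = Finite_Cartesian_Product.mat 1"
    using SU2_inv assms by simp
  moreover have "Determinants.det (u ** v) = 1"
    using assms by (simp add: SU2_def Determinants.det_mul)
  ultimately show ?thesis by (simp add: SU2_def SU2_inv_def)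
qed

lemma vmul_nth_2:
  "(z v* u) $ j = z $ 1 * u $ 1 $ j + z $ 2 * u $ 2 $ j" for u :: "complex ^ 2 ^ 2"
  by (simp add: vector_matrix_mult_def sum_2 mult.commute)

text \<open>The spectral theorem in dimension two. A unit eigenvector is completed to a matrix
  \<open>w\<close> in SU(2); the conjugate of \<open>u\<close> by \<open>w\<close> then has lower
  left entry 0, and inside SU(2) this already forces it to be diagonal.\<close>

lemma SU2_diagonalize:
  assumes u: "u \<in> SU2"
  obtains w \<zeta> where "w \<in> SU2" "cmod \<zeta> = 1" "u ** w = w ** SU2_mat \<zeta> 0"
proof (cases "u $ 1 $ 2 = 0")
  case True
  hence "u $ 2 $ 1 = 0" using u by (simp add: SU2_iff)
  hence "u = SU2_mat (u $ 1 $ 1) 0" and sq: "(cmod (u $ 1 $ 1))\<^sup>2 = 1"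
    using u True by (auto simp: SU2_iff vec_eq_iff forall_2)
  moreover from sq have "cmod (u $ 1 $ 1) = 1"
    using power2_eq_imp_eq[of "cmod (u $ 1 $ 1)" 1] by simp
  moreover have "Finite_Cartesian_Product.mat 1 \<in> SU2"
    by (simp add: SU2_iff Finite_Cartesian_Product.mat_def)
  ultimately show ?thesis
    by (intro that[of "Finite_Cartesian_Product.mat 1" "u $ 1 $ 1"]) auto
next
  case False
  define a b c d where abcd: "a = u $ 1 $ 1" "b = u $ 1 $ 2" "c = u $ 2 $ 1" "d = u $ 2 $ 2"
  \<comment> \<open>A root of the characteristic polynomial, whose constant term is the determinant
    1; either root would serve.\<close>
  define \<zeta> where "\<zeta> = (a + d + csqrt ((a + d)\<^sup>2 - 4)) / 2"
  have "2 * \<zeta> - (a + d) = csqrt ((a + d)\<^sup>2 - 4)"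
    by (simp add: \<zeta>_def field_simps)
  hence "(2 * \<zeta> - (a + d))\<^sup>2 = (a + d)\<^sup>2 - 4" by simp
  hence "4 * (\<zeta>\<^sup>2 - (a + d) * \<zeta> + 1) = 0"
    by (simp add: power2_eq_square algebra_simps)
  hence "\<zeta>\<^sup>2 - (a + d) * \<zeta> + 1 = 0"
    by (subst (asm) mult_eq_0_iff) simp
  hence lam: "\<zeta> * \<zeta> = (a + d) * \<zeta> - 1"
    by (simp add: power2_eq_square algebra_simps)
  have det: "a * d - b * c = 1"
    using u by (simp add: SU2_def Determinants.det_2 abcd)
  \<comment> \<open>The column \<open>(b, \<zeta> - a)\<close> is an eigenvector for
    \<open>\<zeta>\<close>: the first row is immediate, the second is the characteristic equation.
    It is nonzero because \<open>b\<close> is nonzero in this case, and \<open>r\<close> is its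
    length.\<close>
  define r where "r = sqrt ((cmod b)\<^sup>2 + (cmod (\<zeta> - a))\<^sup>2)"
  have r: "r > 0" "r\<^sup>2 = (cmod b)\<^sup>2 + (cmod (\<zeta> - a))\<^sup>2"
    using False by (auto simp: r_def abcd add_pos_nonneg)
  define x y where "x = b / of_real r" and "y = (\<zeta> - a) / of_real r"
  have xy: "(cmod x)\<^sup>2 + (cmod y)\<^sup>2 = 1"
  proof -
    have "(cmod x)\<^sup>2 + (cmod y)\<^sup>2 = ((cmod b)\<^sup>2 + (cmod (\<zeta> - a))\<^sup>2) / r\<^sup>2"
      by (simp add: x_def y_def norm_divide power_divide add_divide_distrib)
    thus ?thesis unfolding r(2)[symmetric] using r(1) by simp
  qed
  have eig: "a * x + b * y = \<zeta> * x" "c * x + d * y = \<zeta> * y"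
  proof -
    have "a * b + b * (\<zeta> - a) = \<zeta> * b" by (simp add: algebra_simps)
    moreover have "c * b + d * (\<zeta> - a) = \<zeta> * (\<zeta> - a)" using lam det by (simp add: algebra_simps)
    ultimately show "a * x + b * y = \<zeta> * x" "c * x + d * y = \<zeta> * y"
      by (simp_all add: x_def y_def flip: add_divide_distrib)
  qed
  \<comment> \<open>The first column of this matrix is the unit eigenvector
    \<open>(x, y)\<close>.\<close>
  define w where "w = SU2_mat x (- cnj y)"
  have w: "w \<in> SU2" using xy by (auto simp: w_def intro!: SU2_mat_in_SU2)
  define v where "v = SU2_inv w ** u ** w"
  have v: "v \<in> SU2" using SU2_mult SU2_inv u w by (simp add: v_def)
  have wv: "w ** v = u ** w"
    by (simp add: v_def matrix_mul_assoc SU2_inv[OF w])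
  have "v $ 2 $ 1 = - y * (a * x + b * y) + x * (c * x + d * y)"
    by (simp add: v_def w_def SU2_inv_def matrix_matrix_mult_def sum_2 abcd algebra_simps)
  also have "\<dots> = 0" by (simp add: eig)
  finally have 0: "v $ 2 $ 1 = 0" .
  hence "v = SU2_mat (v $ 1 $ 1) 0" and 1: "(cmod (v $ 1 $ 1))\<^sup>2 = 1"
    using v by (auto simp: SU2_iff vec_eq_iff forall_2)
  moreover from 1 have "cmod (v $ 1 $ 1) = 1"
    using power2_eq_imp_eq[of "cmod (v $ 1 $ 1)" 1] by simp
  ultimately show ?thesis using that w wv by metis
qed

section \<open>The spin representations in the monomial basis and in other bases\<close>

definition binary_monomial :: "nat \<Rightarrow> nat \<Rightarrow> complex ^ 2 \<Rightarrow> complex" where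
  "binary_monomial n k z = (z $ 1) ^ (n - k) * (z $ 2) ^ k"

text \<open>The coefficient of \<open>binary_monomial n l\<close> in the substituted monomial
  \<open>binary_monomial n k (z v* u)\<close>, read off from the product of two binomial expansions.
  Being an explicit polynomial in the entries of \<open>u\<close>, it is visibly continuous, and
  bounded on SU(2).\<close>

definition spin_matrix :: "nat \<Rightarrow> complex ^ 2 ^ 2 \<Rightarrow> nat \<Rightarrow> nat \<Rightarrow> complex" where
  "spin_matrix n u l k =
     (\<Sum>i\<le>n - k. \<Sum>j\<le>k. if i + j = l then
        of_nat ((n - k) choose i) * (u $ 1 $ 1) ^ (n - k - i) * (u $ 2 $ 1) ^ i *
        (of_nat (k choose j) * (u $ 1 $ 2) ^ (k - j) * (u $ 2 $ 2) ^ j) else 0)"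

lemma binary_monomial_vmul:
  assumes "k \<le> n"
  shows "binary_monomial n k (z v* u) = (\<Sum>l\<le>n. spin_matrix n u l k * binary_monomial n l z)"
proof -
  define A where "A i = of_nat ((n - k) choose i) * (u $ 1 $ 1) ^ (n - k - i) * (u $ 2 $ 1) ^ i" for i
  define B where "B j = of_nat (k choose j) * (u $ 1 $ 2) ^ (k - j) * (u $ 2 $ 2) ^ j" for j
  have A: "((z v* u) $ 1) ^ (n - k) = (\<Sum>i\<le>n - k. A i * ((z $ 1) ^ (n - k - i) * (z $ 2) ^ i))"
    unfolding vmul_nth_2 add.commute[of "z $ 1 * _"] binomial_ring
    by (simp add: A_def power_mult_distrib mult_ac)
  have B: "((z v* u) $ 2) ^ k = (\<Sum>j\<le>k. B j * ((z $ 1) ^ (k - j) * (z $ 2) ^ j))"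
    unfolding vmul_nth_2 add.commute[of "z $ 1 * _"] binomial_ring
    by (simp add: B_def power_mult_distrib mult_ac)
  have "binary_monomial n k (z v* u) =
      (\<Sum>i\<le>n - k. \<Sum>j\<le>k. A i * B j * binary_monomial n (i + j) z)"
    unfolding binary_monomial_def A B sum_product
  proof (intro sum.cong refl)
    fix i j assume "i \<in> {..n - k}" "j \<in> {..k}"
    hence "n - (i + j) = (n - k - i) + (k - j)" using assms by auto
    thus "A i * (z $ 1 ^ (n - k - i) * z $ 2 ^ i) * (B j * (z $ 1 ^ (k - j) * z $ 2 ^ j)) =
       A i * B j * (z $ 1 ^ (n - (i + j)) * z $ 2 ^ (i + j))"
      by (simp add: power_add mult_ac)
  qed
  \<comment> \<open>Inserting a sum over \<open>l\<close> that is supported on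
    \<open>i + j = l\<close> allows equal powers to be collected by exchanging sums.\<close>
  also have "\<dots> = (\<Sum>i\<le>n - k. \<Sum>j\<le>k. \<Sum>l\<le>n. (if i + j = l then A i * B j else 0) * binary_monomial n l z)"
  proof (intro sum.cong refl)
    fix i j assume "i \<in> {..n - k}" "j \<in> {..k}"
    hence "i + j \<le> n" using assms by auto
    thus "A i * B j * binary_monomial n (i + j) z =
        (\<Sum>l\<le>n. (if i + j = l then A i * B j else 0) * binary_monomial n l z)"
      by (simp add: if_distrib[of "\<lambda>x. x * _"] cong: if_cong)
  qed
  also have "\<dots> = (\<Sum>i\<le>n - k. \<Sum>l\<le>n. \<Sum>j\<le>k. (if i + j = l then A i * B j else 0) * binary_monomial n l z)"
    by (intro sum.cong refl sum.swap)
  also have "\<dots> = (\<Sum>l\<le>n. \<Sum>i\<le>n - k. \<Sum>j\<le>k. (if i + j = l then A i * B j else 0) * binary_monomial n l z)"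
    by (rule sum.swap)
  also have "\<dots> = (\<Sum>l\<le>n. spin_matrix n u l k * binary_monomial n l z)"
    unfolding spin_matrix_def A_def B_def by (simp add: sum_distrib_right)
  finally show ?thesis .
qed

text \<open>Setting the first variable to 1 leaves a polynomial in one variable that vanishes
  identically.\<close>

lemma binary_monomials_independent:
  assumes "\<And>z. (\<Sum>k\<le>n. a k * binary_monomial n k z) = 0" "k \<le> n"
  shows "a k = 0"
proof -
  have "(\<Sum>k\<le>n. a k * x ^ k) = 0" for x
    using assms(1)[of "vector [1, x]"] by (simp add: binary_monomial_def)
  thus ?thesis using polyfun_eq_0[of a n] assms(2) by blast
qed

lemma spin_degree_half [simp]: "spin_degree (real n / 2) = n"
  by (simp add: spin_degree_def)

lemma spin_space_half:
  "spin_space (real n / 2) = {P. \<exists>a. P = (\<lambda>z. \<Sum>k\<le>n. a k * binary_monomial n k z)}"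
  by (simp add: spin_space_def binary_monomial_def mult.assoc)

text \<open>The index is the degree, twice the spin.\<close>

definition spin_char :: "nat \<Rightarrow> complex ^ 2 ^ 2 \<Rightarrow> complex" where
  "spin_char n u = (\<Sum>k\<le>n. spin_matrix n u k k)"

text \<open>\<open>S\<close> expands the basis \<open>b\<close> in monomials and \<open>R\<close>
  expands monomials in \<open>b\<close>, so \<open>T\<close> is a conjugate of the monomial matrix.
  The order of quantifiers matters: \<open>R\<close> and \<open>S\<close> do not depend on
  \<open>u\<close>, hence the entries of \<open>T\<close> are fixed linear combinations of those of
  \<open>spin_matrix\<close> and inherit their integrability properties.\<close>

lemma basis_change:
  assumes b: "is_basis_of (Suc n) b (spin_space (real n / 2))"
  shows "\<exists>R S. \<forall>u T. (\<forall>j\<le>n. \<forall>z. b j (z v* u) = (\<Sum>i\<le>n. T i j * b i z)) \<longrightarrow>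
       (\<forall>i\<le>n. \<forall>j\<le>n. T i j = (\<Sum>l\<le>n. \<Sum>k\<le>n. R l i * spin_matrix n u l k * S j k)) \<and>
       (\<Sum>i\<le>n. T i i) = spin_char n u"
proof -
  have "\<forall>j\<in>{..n}. \<exists>a. b j = (\<lambda>z. \<Sum>k\<le>n. a k * binary_monomial n k z)"
    using b by (auto simp: is_basis_of_def spin_space_half less_Suc_eq_le)
  then obtain S where "\<forall>j\<in>{..n}. b j = (\<lambda>z. \<Sum>k\<le>n. S j k * binary_monomial n k z)"
    unfolding bchoice_iff by blast
  then have S: "b j z = (\<Sum>k\<le>n. S j k * binary_monomial n k z)" if "j \<le> n" for j z
    using that by simp
  have indep: "a i = 0" if "\<And>z. (\<Sum>j\<le>n. a j * b j z) = 0" "i \<le> n" for a i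
  proof -
    have "(\<lambda>z. \<Sum>j<Suc n. a j * b j z) = (\<lambda>z. 0)"
      by (intro ext) (simp only: lessThan_Suc_atMost that)
    thus ?thesis using b that(2) unfolding is_basis_of_def less_Suc_eq_le by blast
  qed
  have "binary_monomial n k \<in> spin_space (real n / 2)" if "k \<le> n" for k
    unfolding spin_space_half mem_Collect_eq using that
    by (intro exI[of _ "\<lambda>i. if i = k then 1 else 0"])
       (simp add: if_distrib[of "\<lambda>x. x * _"] cong: if_cong)
  hence "\<forall>k\<in>{..n}. \<exists>a. binary_monomial n k = (\<lambda>z. \<Sum>j\<le>n. a j * b j z)"
    using b by (simp add: is_basis_of_def lessThan_Suc_atMost)
  then obtain R where "\<forall>k\<in>{..n}. binary_monomial n k = (\<lambda>z. \<Sum>j\<le>n. R k j * b j z)"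
    unfolding bchoice_iff by blast
  then have R: "binary_monomial n k z = (\<Sum>j\<le>n. R k j * b j z)" if "k \<le> n" for k z
    using that by simp
  \<comment> \<open>Expanding a monomial in \<open>b\<close> and back again shows that the matrix
    product of \<open>R\<close> and \<open>S\<close> is the identity; this is what cancels in the
    trace.\<close>
  have SR: "(\<Sum>i\<le>n. S i k * R l i) = (if k = l then 1 else 0)" if kl: "k \<le> n" "l \<le> n" for k l
  proof -
    have "(\<Sum>k\<le>n. ((\<Sum>i\<le>n. S i k * R l i) - (if k = l then 1 else 0)) * binary_monomial n k z) = 0" for z
    proof -
      have "binary_monomial n l z = (\<Sum>i\<le>n. R l i * (\<Sum>k\<le>n. S i k * binary_monomial n k z))"
        unfolding R[OF kl(2)] by (intro sum.cong refl) (simp add: S)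
      also have "\<dots> = (\<Sum>k\<le>n. (\<Sum>i\<le>n. S i k * R l i) * binary_monomial n k z)"
        unfolding sum_distrib_left sum_distrib_right
        by (subst sum.swap) (simp add: mult_ac)
      finally show ?thesis using kl
        by (simp add: left_diff_distrib sum_subtractf if_distrib[of "\<lambda>x. x * _"] cong: if_cong)
    qed
    from binary_monomials_independent[OF this kl(1)] show ?thesis by simp
  qed
  show ?thesis
  proof (rule exI[of _ R], rule exI[of _ S], intro allI impI, rule conjI)
    fix u T assume T: "\<forall>j\<le>n. \<forall>z. b j (z v* u) = (\<Sum>i\<le>n. T i j * b i z)"
    have eq: "T i j = (\<Sum>l\<le>n. \<Sum>k\<le>n. R l i * spin_matrix n u l k * S j k)" if ij: "i \<le> n" "j \<le> n" for i j
    proof -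
      have "(\<Sum>i\<le>n. (T i j - (\<Sum>l\<le>n. \<Sum>k\<le>n. R l i * spin_matrix n u l k * S j k)) * b i z) = 0" for z
      proof -
        have "(\<Sum>i\<le>n. T i j * b i z) = b j (z v* u)" using T ij by simp
        also have "\<dots> = (\<Sum>k\<le>n. S j k * (\<Sum>l\<le>n. spin_matrix n u l k * binary_monomial n l z))"
          using ij by (simp add: S binary_monomial_vmul)
        also have "\<dots> = (\<Sum>k\<le>n. S j k * (\<Sum>l\<le>n. spin_matrix n u l k * (\<Sum>i\<le>n. R l i * b i z)))"
          by (simp add: R)
        also have "\<dots> = (\<Sum>k\<le>n. \<Sum>l\<le>n. \<Sum>i\<le>n. R l i * spin_matrix n u l k * S j k * b i z)"
          by (simp add: sum_distrib_left mult_ac)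
        also have "\<dots> = (\<Sum>l\<le>n. \<Sum>k\<le>n. \<Sum>i\<le>n. R l i * spin_matrix n u l k * S j k * b i z)"
          by (rule sum.swap)
        also have "\<dots> = (\<Sum>l\<le>n. \<Sum>i\<le>n. \<Sum>k\<le>n. R l i * spin_matrix n u l k * S j k * b i z)"
          by (intro sum.cong refl sum.swap)
        also have "\<dots> = (\<Sum>i\<le>n. \<Sum>l\<le>n. \<Sum>k\<le>n. R l i * spin_matrix n u l k * S j k * b i z)"
          by (rule sum.swap)
        finally show ?thesis
          by (simp add: left_diff_distrib sum_subtractf sum_distrib_right)
      qed
      from indep[OF this ij(1)] show ?thesis by simp
    qed
    thus "\<forall>i\<le>n. \<forall>j\<le>n. T i j = (\<Sum>l\<le>n. \<Sum>k\<le>n. R l i * spin_matrix n u l k * S j k)" by blast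
    have "(\<Sum>i\<le>n. T i i) = (\<Sum>i\<le>n. \<Sum>l\<le>n. \<Sum>k\<le>n. R l i * spin_matrix n u l k * S i k)"
      using eq by simp
    also have "\<dots> = (\<Sum>l\<le>n. \<Sum>i\<le>n. \<Sum>k\<le>n. R l i * spin_matrix n u l k * S i k)"
      by (rule sum.swap)
    also have "\<dots> = (\<Sum>l\<le>n. \<Sum>k\<le>n. \<Sum>i\<le>n. R l i * spin_matrix n u l k * S i k)"
      by (intro sum.cong refl sum.swap)
    also have "\<dots> = (\<Sum>l\<le>n. \<Sum>k\<le>n. spin_matrix n u l k * (\<Sum>i\<le>n. S i k * R l i))"
      by (simp add: sum_distrib_left mult_ac)
    also have "\<dots> = spin_char n u"
      by (simp add: spin_char_def SR if_distrib[of "\<lambda>x. _ * x"] cong: if_cong)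
    finally show "(\<Sum>i\<le>n. T i i) = spin_char n u" .
  qed
qed

text \<open>Substituting \<open>z v* w\<close> is invertible on the space, with the substitution by
  \<open>SU2_inv w\<close> as inverse. With a diagonalizing \<open>w\<close> this is a basis of
  eigenvectors for the action.\<close>

lemma binary_monomials_translate_basis:
  assumes w: "w \<in> SU2"
  shows "is_basis_of (Suc n) (\<lambda>j z. binary_monomial n j (z v* w)) (spin_space (real n / 2))"
  unfolding is_basis_of_def lessThan_Suc_atMost less_Suc_eq_le
proof (intro conjI ballI allI impI)
  fix j assume "j \<le> n"
  thus "(\<lambda>z. binary_monomial n j (z v* w)) \<in> spin_space (real n / 2)"
    by (auto simp: spin_space_half binary_monomial_vmul)
next
  fix P assume "P \<in> spin_space (real n / 2)"
  then obtain a where a: "P = (\<lambda>z. \<Sum>k\<le>n. a k * binary_monomial n k z)"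
    by (auto simp: spin_space_half)
  have "P z = (\<Sum>l\<le>n. (\<Sum>k\<le>n. a k * spin_matrix n (SU2_inv w) l k) * binary_monomial n l (z v* w))" for z
  proof -
    have "P z = P ((z v* w) v* SU2_inv w)"
      by (simp add: vector_matrix_mul_assoc SU2_inv[OF w])
    also have "\<dots> = (\<Sum>k\<le>n. \<Sum>l\<le>n. a k * spin_matrix n (SU2_inv w) l k * binary_monomial n l (z v* w))"
      by (simp add: a binary_monomial_vmul sum_distrib_left mult_ac del: vector_matrix_mul_assoc)
    finally show ?thesis
      by (subst (asm) sum.swap) (simp add: sum_distrib_right)
  qed
  thus "\<exists>a. P = (\<lambda>z. \<Sum>j\<le>n. a j * binary_monomial n j (z v* w))"
    by (intro exI ext)
next
  fix a k assume *: "(\<lambda>z. \<Sum>j\<le>n. a j * binary_monomial n j (z v* w)) = (\<lambda>z. 0)" "k \<le> n"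
  have "(\<Sum>j\<le>n. a j * binary_monomial n j z) = 0" for z
    using fun_cong[OF *(1), of "z v* SU2_inv w"]
    by (simp add: vector_matrix_mul_assoc SU2_inv[OF w])
  thus "a k = 0" using binary_monomials_independent *(2) by blast
qed

section \<open>Characters and the Clebsch-Gordan identity\<close>

lemma spin_char_eq:
  assumes "u \<in> SU2"
  obtains \<zeta> where "cmod \<zeta> = 1" "\<forall>n. spin_char n u = (\<Sum>k\<le>n. \<zeta> ^ (n - k) * cnj \<zeta> ^ k)"
proof -
  obtain w \<zeta> where w: "w \<in> SU2" "cmod \<zeta> = 1" "u ** w = w ** SU2_mat \<zeta> 0"
    by (rule SU2_diagonalize[OF assms])
  have "spin_char n u = (\<Sum>k\<le>n. \<zeta> ^ (n - k) * cnj \<zeta> ^ k)" for n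
  proof -
    \<comment> \<open>In the monomials translated by \<open>w\<close> the action of \<open>u\<close>
      is diagonal, with these entries. Since \<open>\<zeta>\<close> was obtained before
      \<open>n\<close> was fixed, characters of different degrees can be compared at the same
      \<open>u\<close>.\<close>
    define T where "T i j = (if i = j then \<zeta> ^ (n - i) * cnj \<zeta> ^ i else 0)" for i j :: nat
    have "binary_monomial n j (z v* u v* w) = (\<Sum>i\<le>n. T i j * binary_monomial n i (z v* w))"
      if "j \<le> n" for j z
    proof -
      have "binary_monomial n j (z v* u v* w) = binary_monomial n j ((z v* w) v* SU2_mat \<zeta> 0)"
        by (simp add: vector_matrix_mul_assoc w(3))
      also have "\<dots> = T j j * binary_monomial n j (z v* w)"
        unfolding binary_monomial_def vmul_nth_2[of "z v* w"] by (simp add: T_def power_mult_distrib mult_ac)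
      finally show ?thesis
        using that by (simp add: T_def if_distrib[of "\<lambda>x. x * _"] cong: if_cong)
    qed
    with basis_change[OF binary_monomials_translate_basis[OF w(1), of n]]
    have "(\<Sum>i\<le>n. T i i) = spin_char n u" by blast
    thus ?thesis by (simp add: T_def)
  qed
  thus ?thesis using that w(2) by blast
qed

text \<open>For distinct \<open>x\<close> and \<open>y\<close>, \<open>s n\<close> is the quotient
  of \<open>x ^ (n + 1) - y ^ (n + 1)\<close> by \<open>x - y\<close>. Working with recurrences
  instead avoids a case distinction at \<open>x = y\<close>. The induction on \<open>n\<close> comes
  down to expressing \<open>s (2 * n + 2)\<close> as the difference of the squares of
  \<open>s (n + 1)\<close> and \<open>s n\<close>.\<close>

lemma Clebsch_Gordan_circle:
  fixes x y :: complex
  assumes xy: "x * y = 1"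
  defines "s \<equiv> \<lambda>n. \<Sum>k\<le>n. x ^ (n - k) * y ^ k"
  shows "s n * s n = (\<Sum>k\<le>n. s (2 * k))"
proof -
  have 1: "s (Suc n) = x * s n + y ^ Suc n" for n
    by (simp add: s_def sum_distrib_left Suc_diff_le mult_ac)
  have 2: "s (Suc n) = x ^ Suc n + y * s n" for n
    by (simp add: s_def sum_distrib_left sum.atMost_Suc_shift mult_ac del: sum.atMost_Suc)
  \<comment> \<open>This splits the sum after the term with index \<open>n\<close>: the terms up to
    there share the factor \<open>x ^ Suc m\<close>, the later ones the factor
    \<open>y ^ Suc n\<close>.\<close>
  have 3: "s (n + Suc m) = x ^ Suc m * s n + y ^ Suc n * s m" for n m
  proof (induction m arbitrary: n)
    case 0
    show ?case using 1[of n] by (simp add: s_def)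
  next
    case (Suc m)
    have "s (n + Suc (Suc m)) = x ^ Suc m * s (Suc n) + y ^ Suc (Suc n) * s m"
      using Suc.IH[of "Suc n"] by simp
    also have "\<dots> = x ^ Suc (Suc m) * s n + y ^ Suc n * (x ^ Suc m + y * s m)"
      by (subst 1) (simp add: algebra_simps)
    finally show ?case by (simp add: 2)
  qed
  show ?thesis
  proof (induction n)
    case (Suc n)
    have "s (2 * Suc n) = x ^ Suc (Suc n) * s n + y ^ Suc n * s (Suc n)"
      using 3[of n "Suc n"] by (simp add: mult_2)
    also have "\<dots> = x ^ Suc (Suc n) * s n + y ^ Suc n * (x ^ Suc n + y * s n)"
      by (simp only: 2)
    also have "\<dots> = s (Suc n) * s (Suc n) - s n * s n"
    proof -
      have "s (Suc n) * s (Suc n) = (x * s n + y ^ Suc n) * (x ^ Suc n + y * s n)"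
        using 1[of n] 2[of n] by simp
      also have "\<dots> = x ^ Suc (Suc n) * s n + (x * y) * (s n * s n) + y ^ Suc n * (x ^ Suc n + y * s n)"
        by (simp add: algebra_simps)
      finally show ?thesis by (simp add: xy)
    qed
    finally show ?case using Suc by simp
  qed (simp add: s_def)
qed

text \<open>Conjugation reverses the order of the sum over powers of the eigenvalue, so the
  character is real on SU(2) and its squared modulus is its square. The right side is linear in
  characters, so the square norm can be computed from their means alone.\<close>

lemma spin_char_norm_square:
  assumes "u \<in> SU2"
  shows "of_real ((cmod (spin_char n u))\<^sup>2) = (\<Sum>k\<le>n. spin_char (2 * k) u)"
proof -
  obtain x where x: "cmod x = 1" "\<forall>n. spin_char n u = (\<Sum>k\<le>n. x ^ (n - k) * cnj x ^ k)"
    by (rule spin_char_eq[OF assms])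
  have xy: "x * cnj x = 1" using x(1) by (simp flip: complex_norm_square)
  have "cnj (spin_char n u) = (\<Sum>k\<le>n. x ^ k * cnj x ^ (n - k))"
    using x(2) by (simp add: mult_ac)
  also have "\<dots> = (\<Sum>k\<le>n. x ^ (n - k) * cnj x ^ k)"
    by (rule sum.reindex_bij_witness[of _ "\<lambda>k. n - k" "\<lambda>k. n - k"]) auto
  finally have "cnj (spin_char n u) = spin_char n u" using x(2) by simp
  hence "of_real ((cmod (spin_char n u))\<^sup>2) = spin_char n u * spin_char n u"
    by (simp add: complex_norm_square del: of_real_power)
  also have "\<dots> = (\<Sum>k\<le>n. spin_char (2 * k) u)"
    using Clebsch_Gordan_circle[OF xy, of n] x(2) by simp
  finally show ?thesis .
qed

section \<open>Regularity of the matrix entries and integration against Haar measure\<close>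

lemma continuous_on_mat_nth [continuous_intros]:
  fixes f :: "'a :: topological_space \<Rightarrow> complex ^ 'n ^ 'm"
  shows "continuous_on S f \<Longrightarrow> continuous_on S (\<lambda>x. f x $ i $ j)"
  by (intro continuous_on_component)

lemma continuous_on_spin_matrix: "continuous_on S (\<lambda>u. spin_matrix n u l k)"
  unfolding spin_matrix_def
proof (intro continuous_on_sum)
  fix i j
  show "continuous_on S (\<lambda>u. if i + j = l then
     of_nat ((n - k) choose i) * (u $ 1 $ 1) ^ (n - k - i) * (u $ 2 $ 1) ^ i *
        (of_nat (k choose j) * (u $ 1 $ 2) ^ (k - j) * (u $ 2 $ 2) ^ j) else 0)"
    by (cases "i + j = l") (auto intro!: continuous_intros)
qed

lemma spin_matrix_bounded: "\<exists>C. \<forall>u\<in>SU2. cmod (spin_matrix n u l k) \<le> C"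
proof (intro exI ballI)
  fix u assume u: "u \<in> SU2"
  have le: "cmod (u $ i $ j) ^ m \<le> 1" for i j m
    by (simp add: power_le_one SU2_norm_nth_le_1 u)
  show "cmod (spin_matrix n u l k) \<le> (\<Sum>i\<le>n - k. \<Sum>j\<le>k. real ((n - k) choose i) * real (k choose j))"
    unfolding spin_matrix_def
  proof (intro sum_norm_le)
    fix i j
    have "cmod (of_nat ((n - k) choose i) * (u $ 1 $ 1) ^ (n - k - i) * (u $ 2 $ 1) ^ i *
        (of_nat (k choose j) * (u $ 1 $ 2) ^ (k - j) * (u $ 2 $ 2) ^ j))
      \<le> real ((n - k) choose i) * 1 * 1 * (real (k choose j) * 1 * 1)"
      unfolding norm_mult norm_power norm_of_nat by (intro mult_mono le) auto
    thus "cmod (if i + j = l then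
        of_nat ((n - k) choose i) * (u $ 1 $ 1) ^ (n - k - i) * (u $ 2 $ 1) ^ i *
        (of_nat (k choose j) * (u $ 1 $ 2) ^ (k - j) * (u $ 2 $ 2) ^ j) else 0)
      \<le> real ((n - k) choose i) * real (k choose j)" by auto
  qed
qed

lemma haar_space: "normalized_haar_SU2 \<mu> \<Longrightarrow> space \<mu> = SU2"
  by (simp add: normalized_haar_SU2_def)

lemma haar_prob_space: "normalized_haar_SU2 \<mu> \<Longrightarrow> finite_measure \<mu> \<and> measure \<mu> (space \<mu>) = 1"
  by (auto simp: normalized_haar_SU2_def measure_def intro!: finite_measureI)

lemma haar_borel_measurable:
  assumes "normalized_haar_SU2 \<mu>" "f \<in> borel_measurable borel"
  shows "f \<in> borel_measurable \<mu>"
proof -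
  have "f \<in> borel_measurable (restrict_space borel SU2)"
    using assms(2) by (rule measurable_restrict_space1)
  thus ?thesis
    using assms(1) by (simp add: normalized_haar_SU2_def cong: measurable_cong_sets)
qed

text \<open>Invariance is given for images of sets, whereas a push-forward involves preimages. As
  left translation by \<open>v\<close> is a bijection of SU(2), each measurable set is the image of
  its preimage, and so the push-forward of \<open>\<mu>\<close> is \<open>\<mu>\<close>.\<close>

lemma haar_integral_translate:
  fixes g :: "complex ^ 2 ^ 2 \<Rightarrow> complex"
  assumes \<mu>: "normalized_haar_SU2 \<mu>" and v: "v \<in> SU2" and g: "g \<in> borel_measurable \<mu>"
  shows "(\<integral>u. g (v ** u) \<partial>\<mu>) = (\<integral>u. g u \<partial>\<mu>)"
proof -
  have "continuous_on UNIV (\<lambda>u. v ** u)"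
    unfolding matrix_matrix_mult_def by (intro continuous_on_vec_lambda continuous_intros)
  hence "(\<lambda>u. v ** u) \<in> measurable \<mu> borel"
    using \<mu> by (auto simp: normalized_haar_SU2_def cong: measurable_cong_sets
        intro!: measurable_restrict_space1 borel_measurable_continuous_onI)
  hence "(\<lambda>u. v ** u) \<in> measurable \<mu> (restrict_space borel SU2)"
    using \<mu> v by (intro measurable_restrict_space2) (auto simp: haar_space SU2_mult)
  hence meas: "(\<lambda>u. v ** u) \<in> measurable \<mu> \<mu>"
    using \<mu> measurable_cong_sets[of \<mu> \<mu> \<mu> "restrict_space borel SU2"]
    by (simp add: normalized_haar_SU2_def)
  have "distr \<mu> \<mu> (\<lambda>u. v ** u) = \<mu>"
  proof (rule measure_eqI)
    fix A assume "A \<in> sets (distr \<mu> \<mu> (\<lambda>u. v ** u))"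
    hence A: "A \<in> sets \<mu>" by simp
    hence sub: "A \<subseteq> SU2" using sets.sets_into_space haar_space[OF \<mu>] by metis
    define B where "B = (\<lambda>u. v ** u) -` A \<inter> space \<mu>"
    have "(\<lambda>u. v ** u) ` B = A"
    proof (intro equalityI subsetI)
      fix a assume a: "a \<in> A"
      have "a = v ** (SU2_inv v ** a)" by (simp add: matrix_mul_assoc SU2_inv[OF v])
      moreover from this have "SU2_inv v ** a \<in> B"
        using a sub SU2_inv[OF v] by (auto simp: B_def haar_space[OF \<mu>] intro!: SU2_mult)
      ultimately show "a \<in> (\<lambda>u. v ** u) ` B" by blast
    qed (auto simp: B_def)
    moreover have "B \<in> sets \<mu>" unfolding B_def by (rule measurable_sets[OF meas A])
    ultimately have "emeasure \<mu> B = emeasure \<mu> A"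
      using \<mu> v unfolding normalized_haar_SU2_def by metis
    thus "emeasure (distr \<mu> \<mu> (\<lambda>u. v ** u)) A = emeasure \<mu> A"
      by (simp add: emeasure_distr[OF meas A] B_def)
  qed simp
  thus ?thesis using integral_distr[OF meas g] by simp
qed

lemma spin_matrix_integrable:
  assumes \<mu>: "normalized_haar_SU2 \<mu>"
  shows "integrable \<mu> (\<lambda>u. spin_matrix n u l k)"
proof -
  interpret finite_measure \<mu> using haar_prob_space[OF \<mu>] by blast
  obtain C where "\<forall>u\<in>SU2. cmod (spin_matrix n u l k) \<le> C" using spin_matrix_bounded by blast
  thus ?thesis
    by (intro integrable_const_bound[of _ C] haar_borel_measurable[OF \<mu>]
        borel_measurable_continuous_onI continuous_on_spin_matrix)
      (auto simp: haar_space[OF \<mu>])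
qed

section \<open>Means of matrix entries and the square norm of the characters\<close>

lemma SU2_transitive_on_rays:
  fixes z :: "complex ^ 2"
  obtains c w where "w \<in> SU2" "z = c *s (vector [1, 0] v* w)"
proof -
  define r where "r = sqrt ((cmod (z $ 1))\<^sup>2 + (cmod (z $ 2))\<^sup>2)"
  show ?thesis
  proof (cases "r = 0")
    case True
    hence "z = 0" by (auto simp: r_def vec_eq_iff forall_2 sum_power2_eq_zero_iff)
    moreover have "SU2_mat 1 0 \<in> SU2" by (simp add: SU2_mat_in_SU2)
    ultimately show ?thesis using that[of "SU2_mat 1 0" 0] by simp
  next
    case False
    \<comment> \<open>Multiplying the row vector \<open>(1, 0)\<close> by a matrix gives its first
      row, so the normalized \<open>z\<close> is taken as first row.\<close>
    define w where "w = SU2_mat (z $ 1 / of_real r) (z $ 2 / of_real r)"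
    have "r\<^sup>2 = (cmod (z $ 1))\<^sup>2 + (cmod (z $ 2))\<^sup>2" by (simp add: r_def)
    hence "w \<in> SU2" using False
      by (auto simp: w_def norm_divide power_divide simp flip: add_divide_distrib intro!: SU2_mat_in_SU2)
    moreover have "z = of_real r *s (vector [1, 0] v* w)"
      using False by (simp add: vec_eq_iff forall_2 vmul_nth_2 w_def)
    ultimately show ?thesis using that by blast
  qed
qed

lemma binary_monomial_scale:
  "k \<le> n \<Longrightarrow> binary_monomial n k (c *s z) = c ^ n * binary_monomial n k z"
  by (simp add: binary_monomial_def power_mult_distrib mult_ac flip: power_add)

text \<open>These means, for fixed \<open>k\<close>, are the coefficients of the averaged monomial
  \<open>Q\<close>. It is homogeneous of degree \<open>n\<close>, and left invariance of the measure
  makes it invariant under SU(2). The diagonal torus forces \<open>Q e = 0\<close>, transitivity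
  carries this to every vector, and independence of the monomials gives the coefficients.\<close>

lemma spin_matrix_integral_eq_0:
  assumes \<mu>: "normalized_haar_SU2 \<mu>" and n: "n > 0" and k: "k \<le> n" and l: "l \<le> n"
  shows "(\<integral>u. spin_matrix n u l k \<partial>\<mu>) = 0"
proof -
  define Q where "Q z = (\<integral>u. binary_monomial n k (z v* u) \<partial>\<mu>)" for z
  have Q_eq: "Q z = (\<Sum>l\<le>n. (\<integral>u. spin_matrix n u l k \<partial>\<mu>) * binary_monomial n l z)" for z
    using spin_matrix_integrable[OF \<mu>] by (simp add: Q_def binary_monomial_vmul[OF k])
  have meas: "(\<lambda>u. binary_monomial n k (z v* u)) \<in> borel_measurable \<mu>" for z
    unfolding binary_monomial_vmul[OF k]
    by (intro haar_borel_measurable[OF \<mu>] borel_measurable_continuous_onI continuous_intros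
        continuous_on_spin_matrix)
  have inv: "Q (z v* v) = Q z" if "v \<in> SU2" for z v
    using haar_integral_translate[OF \<mu> that meas[of z]] by (simp add: Q_def vector_matrix_mul_assoc)
  have scale: "Q (c *s z) = c ^ n * Q z" for c z
  proof -
    have "(c *s z) v* u = c *s (z v* u)" for u :: "complex ^ 2 ^ 2"
      by (simp add: vec_eq_iff vmul_nth_2 algebra_simps)
    thus ?thesis by (simp add: Q_def binary_monomial_scale[OF k])
  qed
  define e :: "complex ^ 2" where "e = vector [1, 0]"
  have e0: "Q e = 0"
  proof -
    \<comment> \<open>Chosen so that \<open>\<zeta> ^ n = -1\<close>: invariance and homogeneity at
      \<open>e\<close> then disagree by a sign. This uses \<open>n > 0\<close>.\<close>
    define \<zeta> where "\<zeta> = cis (pi / n)"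
    have "\<zeta> ^ n = cis (real n * (pi / real n))"
      unfolding \<zeta>_def by (rule Complex.DeMoivre)
    also have "real n * (pi / real n) = pi" using n by simp
    finally have "\<zeta> ^ n = -1" by simp
    moreover have "e v* SU2_mat \<zeta> 0 = \<zeta> *s e"
      by (simp add: vec_eq_iff forall_2 vmul_nth_2 e_def)
    moreover have "SU2_mat \<zeta> 0 \<in> SU2" by (intro SU2_mat_in_SU2) (simp add: \<zeta>_def)
    ultimately have "Q e = - Q e" using inv[of "SU2_mat \<zeta> 0" e] scale[of \<zeta> e] by simp
    thus ?thesis by simp
  qed
  have Q0: "Q z = 0" for z
  proof -
    obtain c w where "w \<in> SU2" "z = c *s (e v* w)"
      unfolding e_def by (rule SU2_transitive_on_rays)
    thus ?thesis using inv scale e0 by simp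
  qed
  show ?thesis
    by (rule binary_monomials_independent[where a = "\<lambda>l. \<integral>u. spin_matrix n u l k \<partial>\<mu>", OF _ l])
      (simp only: Q0 flip: Q_eq)
qed

lemma spin_char_integrable: "normalized_haar_SU2 \<mu> \<Longrightarrow> integrable \<mu> (spin_char n)"
  unfolding spin_char_def[abs_def] by (intro Bochner_Integration.integrable_sum spin_matrix_integrable)

lemma spin_char_integral:
  assumes \<mu>: "normalized_haar_SU2 \<mu>"
  shows "(\<integral>u. spin_char n u \<partial>\<mu>) = (if n = 0 then 1 else 0)"
proof (cases "n = 0")
  case True
  thus ?thesis using haar_prob_space[OF \<mu>] by (simp add: spin_char_def spin_matrix_def)
next
  case False
  thus ?thesis
    by (simp add: spin_char_def spin_matrix_integrable[OF \<mu>] spin_matrix_integral_eq_0[OF \<mu>])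
qed

text \<open>In the integrated Clebsch-Gordan sum only the term \<open>k = 0\<close>, the trivial
  character, has a nonzero mean.\<close>

lemma spin_char_L2:
  assumes \<mu>: "normalized_haar_SU2 \<mu>"
  shows "integrable \<mu> (\<lambda>u. (cmod (spin_char n u))\<^sup>2)" "(\<integral>u. (cmod (spin_char n u))\<^sup>2 \<partial>\<mu>) = 1"
proof -
  have int: "integrable \<mu> (\<lambda>u. \<Sum>k\<le>n. spin_char (2 * k) u)"
    by (intro Bochner_Integration.integrable_sum spin_char_integrable[OF \<mu>])
  have eq: "(\<Sum>k\<le>n. spin_char (2 * k) u) = complex_of_real ((cmod (spin_char n u))\<^sup>2)"
    if "u \<in> space \<mu>" for u
    using that spin_char_norm_square by (simp add: haar_space[OF \<mu>])
  have "integrable \<mu> (\<lambda>u. complex_of_real ((cmod (spin_char n u))\<^sup>2))"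
    using int eq by (subst (asm) Bochner_Integration.integrable_cong[OF refl eq]) auto
  thus "integrable \<mu> (\<lambda>u. (cmod (spin_char n u))\<^sup>2)"
    by (simp only: complex_of_real_integrable_eq)
  have "complex_of_real (\<integral>u. (cmod (spin_char n u))\<^sup>2 \<partial>\<mu>) = (\<integral>u. complex_of_real ((cmod (spin_char n u))\<^sup>2) \<partial>\<mu>)"
    by (rule integral_complex_of_real[symmetric])
  also have "\<dots> = (\<integral>u. (\<Sum>k\<le>n. spin_char (2 * k) u) \<partial>\<mu>)"
    by (rule Bochner_Integration.integral_cong) (simp_all only: eq)
  also have "\<dots> = (\<Sum>k\<le>n. if k = 0 then 1 else 0)"
    by (simp add: spin_char_integrable[OF \<mu>] spin_char_integral[OF \<mu>])
  also have "\<dots> = 1" by simp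
  finally show "(\<integral>u. (cmod (spin_char n u))\<^sup>2 \<partial>\<mu>) = 1"
    by (simp only: of_real_eq_1_iff)
qed

section \<open>Pairing estimates for functions in the Lebesgue spaces\<close>

lemma powr_ge_square:
  fixes x p :: real
  assumes "0 \<le> x" "2 < p"
  shows "x\<^sup>2 \<le> 1 + x powr p"
proof (cases "x \<le> 1")
  case True
  hence "x\<^sup>2 \<le> 1" using assms(1) by (simp add: power_le_one)
  thus ?thesis using powr_ge_zero[of x p] by linarith
next
  case False
  hence "x powr 2 \<le> x powr p" using assms by (intro powr_mono) auto
  thus ?thesis using False by (simp add: powr_numeral)
qed

lemma Lp_space_integrable:
  assumes "finite_measure M" "f \<in> Lp_space p M" "2 < p"
  shows "integrable M f"
proof -
  interpret finite_measure M by fact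
  show ?thesis
  proof (rule Bochner_Integration.integrable_bound)
    show "integrable M (\<lambda>x. 2 + norm (f x) powr p)" "f \<in> borel_measurable M"
      using assms(2) by (auto simp: Lp_space_def)
    have "norm (f x) \<le> 2 + norm (f x) powr p" for x
    proof -
      have "0 \<le> (norm (f x) - 1)\<^sup>2" by simp
      hence "2 * norm (f x) \<le> 1 + (norm (f x))\<^sup>2" by (simp add: power2_diff)
      hence "norm (f x) \<le> 1 + (norm (f x))\<^sup>2" using norm_ge_zero[of "f x"] by linarith
      thus ?thesis using powr_ge_square[of "norm (f x)" p] assms(3) by simp
    qed
    thus "AE x in M. norm (f x) \<le> norm (2 + norm (f x) powr p)" by (auto intro: order_trans)
  qed
qed

lemma Lp_norm_powr:
  assumes "p > 0"
  shows "Lp_norm p M f powr p = (\<integral>x. norm (f x) powr p \<partial>M)"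
  using assms by (simp add: Lp_norm_def powr_powr)

text \<open>A Young-type argument in place of the Hoelder inequality: after division by the norm
  \<open>N\<close>, the product is bounded pointwise through
  \<open>2 * (y * norm (g x)) \<le> y\<^sup>2 + (norm (g x))\<^sup>2\<close>, and
  \<open>y\<^sup>2\<close> is absorbed into \<open>1 + y powr p\<close>. Cauchy-Schwarz would give
  the constant 1, but any constant suffices here. The case \<open>N = 0\<close>, where the division
  fails, has \<open>f\<close> vanishing almost everywhere.\<close>

lemma norm_integral_le_Lp_norm:
  fixes f g :: "'a \<Rightarrow> complex"
  assumes "finite_measure M" "measure M (space M) = 1" and p: "2 < p" and f: "f \<in> Lp_space p M"
    and g: "integrable M (\<lambda>x. (norm (g x))\<^sup>2)" "(\<integral>x. (norm (g x))\<^sup>2 \<partial>M) = 1"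
  shows "norm (\<integral>x. f x * g x \<partial>M) \<le> 3 / 2 * Lp_norm p M f"
proof -
  interpret finite_measure M by fact
  define N where "N = Lp_norm p M f"
  have N: "N powr p = (\<integral>x. norm (f x) powr p \<partial>M)" using p by (simp add: N_def Lp_norm_powr)
  have fp: "integrable M (\<lambda>x. norm (f x) powr p)" using f by (simp add: Lp_space_def)
  show ?thesis
  proof (cases "N = 0")
    case True
    hence "(\<integral>x. norm (f x) powr p \<partial>M) = 0" using N p by simp
    hence "AE x in M. norm (f x) powr p = 0"
      using integral_nonneg_eq_0_iff_AE[OF fp] by simp
    hence "AE x in M. f x * g x = 0" by eventually_elim (use p in simp)
    thus ?thesis using True by (simp add: integral_eq_zero_AE N_def)
  next
    case False
    hence Npos: "N > 0" by (simp add: N_def Lp_norm_def less_le)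
    \<comment> \<open>Each of the three summands in the bracket has integral 1, which is the origin
      of the factor \<open>3 / 2\<close>.\<close>
    define h where "h x = N / 2 * (1 + norm (f x) powr p / N powr p + (norm (g x))\<^sup>2)" for x
    have h: "integrable M h" "(\<integral>x. h x \<partial>M) = 3 / 2 * N"
      unfolding h_def[abs_def] using fp g Npos assms(2) by (simp_all flip: N)
    have "norm (\<integral>x. f x * g x \<partial>M) \<le> (\<integral>x. norm (f x * g x) \<partial>M)"
      by (rule integral_norm_bound)
    also have "\<dots> \<le> (\<integral>x. h x \<partial>M)"
    proof (rule integral_mono')
      fix x
      define y where "y = norm (f x) / N"
      have "0 \<le> (y - norm (g x))\<^sup>2" by simp
      hence "2 * (y * norm (g x)) \<le> y\<^sup>2 + (norm (g x))\<^sup>2" unfolding power2_diff by simp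
      also have "y\<^sup>2 \<le> 1 + y powr p" using Npos p by (intro powr_ge_square) (auto simp: y_def)
      also have "y powr p = norm (f x) powr p / N powr p"
        using Npos by (simp add: y_def powr_divide)
      finally have "N / 2 * (2 * (y * norm (g x))) \<le> h x"
        unfolding h_def using Npos by (intro mult_left_mono) auto
      thus "norm (f x * g x) \<le> h x" using Npos by (simp add: y_def norm_mult)
      show "0 \<le> h x" using Npos by (simp add: h_def)
    qed (rule h(1))
    finally show ?thesis using h(2) by (simp add: N_def)
  qed
qed

section \<open>Traces of the Fourier coefficients\<close>

lemma mat_adjoint_nth:
  "A \<in> carrier_mat d d \<Longrightarrow> i < d \<Longrightarrow> j < d \<Longrightarrow> mat_adjoint A $$ (i, j) = cnj (A $$ (j, i))"
  by (simp add: mat_adjoint_def mat_of_rows_def)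

text \<open>The diagonal of the adjoint sums to the conjugate of the character. Exchanging this sum
  with the integral requires every diagonal entry to be integrable against \<open>f\<close>. The
  representation is prescribed only pointwise, so this is derived from \<open>basis_change\<close>,
  which writes the entries as combinations of bounded continuous functions.\<close>

lemma trace_fourier_coeff:
  assumes \<mu>: "normalized_haar_SU2 \<mu>" and f: "integrable \<mu> f"
    and t: "unitary_spin_rep (real n / 2) (t (real n / 2))"
  shows "mat_trace (fourier_coeff \<mu> t f (real n / 2)) = (\<integral>u. f u * cnj (spin_char n u) \<partial>\<mu>)"
proof -
  define T where "T = t (real n / 2)"
  obtain b where b: "is_basis_of (Suc n) b (spin_space (real n / 2))"
    and T: "\<And>u. u \<in> SU2 \<Longrightarrow> T u \<in> carrier_mat (Suc n) (Suc n)"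
    and act: "\<And>u j. u \<in> SU2 \<Longrightarrow> j \<le> n \<Longrightarrow>
      spin_action u (b j) = (\<lambda>z. \<Sum>i\<le>n. T u $$ (i, j) * b i z)"
    using t by (auto simp: unitary_spin_rep_def T_def lessThan_Suc_atMost less_Suc_eq_le)
  have act': "b j (z v* u) = (\<Sum>i\<le>n. T u $$ (i, j) * b i z)" if "u \<in> SU2" "j \<le> n" for u j z
    using fun_cong[OF act[OF that], of z] by (simp add: spin_action_def)
  obtain R S where RS: "\<forall>u T. (\<forall>j\<le>n. \<forall>z. b j (z v* u) = (\<Sum>i\<le>n. T i j * b i z)) \<longrightarrow>
       (\<forall>i\<le>n. \<forall>j\<le>n. T i j = (\<Sum>l\<le>n. \<Sum>k\<le>n. R l i * spin_matrix n u l k * S j k)) \<and>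
       (\<Sum>i\<le>n. T i i) = spin_char n u"
    using basis_change[OF b] by blast
  have T_eq: "T u $$ (i, i) = (\<Sum>l\<le>n. \<Sum>k\<le>n. R l i * spin_matrix n u l k * S i k)"
    if "u \<in> SU2" "i \<le> n" for u i
    using RS[rule_format, of u "\<lambda>i j. T u $$ (i, j)"] act'[OF that(1)] that(2) by blast
  have T_trace: "(\<Sum>i\<le>n. T u $$ (i, i)) = spin_char n u" if "u \<in> SU2" for u
    using RS[rule_format, of u "\<lambda>i j. T u $$ (i, j)"] act'[OF that(1)] by blast
  have M_int: "integrable \<mu> (\<lambda>u. f u * cnj (spin_matrix n u l k))" for l k
  proof -
    obtain C where C: "\<And>u. u \<in> SU2 \<Longrightarrow> cmod (spin_matrix n u l k) \<le> C"
      using spin_matrix_bounded by blast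
    show ?thesis
    proof (rule Bochner_Integration.integrable_bound)
      show "integrable \<mu> (\<lambda>u. C * f u)" using f by simp
      show "(\<lambda>u. f u * cnj (spin_matrix n u l k)) \<in> borel_measurable \<mu>"
        by (intro borel_measurable_times borel_measurable_integrable[OF f] haar_borel_measurable[OF \<mu>]
            borel_measurable_continuous_onI continuous_intros continuous_on_spin_matrix)
      show "AE u in \<mu>. cmod (f u * cnj (spin_matrix n u l k)) \<le> cmod (C * f u)"
      proof (rule AE_I2)
        fix u assume "u \<in> space \<mu>"
        hence "cmod (spin_matrix n u l k) \<le> \<bar>C\<bar>" using C haar_space[OF \<mu>] by fastforce
        thus "cmod (f u * cnj (spin_matrix n u l k)) \<le> cmod (C * f u)"
          by (simp add: norm_mult mult.commute[of "\<bar>C\<bar>"] mult_left_mono)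
      qed
    qed
  qed
  have T_int: "integrable \<mu> (\<lambda>u. f u * cnj (T u $$ (i, i)))" if "i \<le> n" for i
  proof -
    have "integrable \<mu> (\<lambda>u. \<Sum>l\<le>n. \<Sum>k\<le>n. cnj (R l i) * cnj (S i k) * (f u * cnj (spin_matrix n u l k)))"
      by (intro Bochner_Integration.integrable_sum integrable_mult_right M_int)
    moreover have "f u * cnj (T u $$ (i, i)) =
        (\<Sum>l\<le>n. \<Sum>k\<le>n. cnj (R l i) * cnj (S i k) * (f u * cnj (spin_matrix n u l k)))"
      if "u \<in> space \<mu>" for u
      using that \<open>i \<le> n\<close> by (simp add: haar_space[OF \<mu>] T_eq sum_distrib_left mult_ac)
    ultimately show ?thesis
      by (subst Bochner_Integration.integrable_cong[OF refl]) auto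
  qed
  have "mat_trace (fourier_coeff \<mu> t f (real n / 2)) =
      (\<Sum>i\<le>n. \<integral>u. f u * mat_adjoint (T u) $$ (i, i) \<partial>\<mu>)"
    by (simp add: mat_trace_def fourier_coeff_def T_def lessThan_Suc_atMost)
  also have "\<dots> = (\<Sum>i\<le>n. \<integral>u. f u * cnj (T u $$ (i, i)) \<partial>\<mu>)"
    by (intro sum.cong refl Bochner_Integration.integral_cong)
      (simp_all add: mat_adjoint_nth[OF T] haar_space[OF \<mu>])
  also have "\<dots> = (\<integral>u. (\<Sum>i\<le>n. f u * cnj (T u $$ (i, i))) \<partial>\<mu>)"
    by (rule Bochner_Integration.integral_sum[symmetric]) (simp add: T_int)
  also have "\<dots> = (\<integral>u. f u * cnj (spin_char n u) \<partial>\<mu>)"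
    by (intro Bochner_Integration.integral_cong refl)
      (simp add: haar_space[OF \<mu>] flip: T_trace sum_distrib_left)
  finally show ?thesis .
qed

lemma norm_trace_fourier_coeff_le:
  assumes \<mu>: "normalized_haar_SU2 \<mu>" and f: "f \<in> Lp_space p \<mu>" and p: "2 < p"
    and t: "unitary_spin_rep (real n / 2) (t (real n / 2))"
  shows "norm (mat_trace (fourier_coeff \<mu> t f (real n / 2))) \<le> 3 / 2 * Lp_norm p \<mu> f"
proof -
  note prob = haar_prob_space[OF \<mu>]
  have "norm (\<integral>u. f u * cnj (spin_char n u) \<partial>\<mu>) \<le> 3 / 2 * Lp_norm p \<mu> f"
    using spin_char_L2[OF \<mu>, of n] by (intro norm_integral_le_Lp_norm p f) (auto simp: prob)
  moreover have "integrable \<mu> f" using prob Lp_space_integrable f p by blast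
  ultimately show ?thesis using trace_fourier_coeff[where t = t, OF \<mu> _ t] by simp
qed

section \<open>Summation over the spins\<close>

theorem theorem2p8:
  fixes p :: real
  assumes "2 < p"
  shows "\<exists>c>0. \<forall>\<mu> t f.
           normalized_haar_SU2 \<mu> \<longrightarrow>
           (\<forall>l\<in>half_nats. unitary_spin_rep l (t l)) \<longrightarrow>
           f \<in> Lp_space p \<mu> \<longrightarrow>
             bdd_above ((\<lambda>k. 1 / (2 * k + 1) * norm (mat_trace (fourier_coeff \<mu> t f k))) ` half_nats) \<and>
             (\<lambda>l. (2 * l + 1) powr (p - 2) * fourier_tail_sup \<mu> t f l powr p) summable_on half_nats \<and>
             (\<Sum>\<^sub>\<infinity>l\<in>half_nats. (2 * l + 1) powr (p - 2) * fourier_tail_sup \<mu> t f l powr p)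
               \<le> c * Lp_norm p \<mu> f powr p"
proof -
  \<comment> \<open>What remains of the weight \<open>(2 * l + 1) powr (p - 2)\<close> once the tail
    supremum contributes \<open>(2 * l + 1) powr (- p)\<close>. At \<open>l = n / 2\<close> it is
    the reciprocal square of \<open>n + 1\<close>.\<close>
  define w where "w = (\<lambda>l::real. 1 / (2 * l + 1)\<^sup>2)"
  have inj: "inj (\<lambda>n::nat. real n / 2)" by (auto intro: injI)
  have "summable (\<lambda>n. norm (1 / real (Suc n) ^ 2))"
    using inverse_squares_sums by (simp add: sums_iff add.commute)
  hence "(\<lambda>n. 1 / real (Suc n) ^ 2) summable_on UNIV"
    by (rule norm_summable_imp_summable_on)
  moreover have "w \<circ> (\<lambda>n::nat. real n / 2) = (\<lambda>n. 1 / real (Suc n) ^ 2)"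
    by (simp add: w_def o_def add.commute)
  ultimately have w: "w summable_on half_nats"
    unfolding half_nats_def by (subst summable_on_reindex[OF inj]) simp
  have w0: "0 \<le> infsum w half_nats" by (rule infsum_nonneg) (simp add: w_def)
  \<comment> \<open>The factor \<open>(3 / 2) powr p\<close> comes from the trace bound; adding 1
    makes \<open>c\<close> positive knowing only that the infinite sum is nonnegative.\<close>
  define c where "c = (3 / 2) powr p * (infsum w half_nats + 1)"
  have main: "bdd_above ((\<lambda>k. 1 / (2 * k + 1) * norm (mat_trace (fourier_coeff \<mu> t f k))) ` half_nats) \<and>
             (\<lambda>l. (2 * l + 1) powr (p - 2) * fourier_tail_sup \<mu> t f l powr p) summable_on half_nats \<and>
             (\<Sum>\<^sub>\<infinity>l\<in>half_nats. (2 * l + 1) powr (p - 2) * fourier_tail_sup \<mu> t f l powr p)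
               \<le> c * Lp_norm p \<mu> f powr p"
    if \<mu>: "normalized_haar_SU2 \<mu>" and t: "\<forall>l\<in>half_nats. unitary_spin_rep l (t l)"
      and f: "f \<in> Lp_space p \<mu>" for \<mu> t f
  proof -
    define N where "N = 3 / 2 * Lp_norm p \<mu> f"
    define x where "x k = 1 / (2 * k + 1) * norm (mat_trace (fourier_coeff \<mu> t f k))" for k
    have N: "N \<ge> 0" by (simp add: N_def Lp_norm_def)
    have nonneg: "k \<ge> 0" if "k \<in> half_nats" for k using that by (auto simp: half_nats_def)
    have trace_le: "norm (mat_trace (fourier_coeff \<mu> t f k)) \<le> N" if "k \<in> half_nats" for k
      using that t norm_trace_fourier_coeff_le[OF \<mu> f assms, of _ t]
      by (auto simp: half_nats_def N_def)
    \<comment> \<open>The trace bound is uniform in \<open>k\<close>, so the factor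
      \<open>1 / (2 * k + 1)\<close> alone yields decay in \<open>l\<close> for the whole tail. The
      case \<open>l = 0\<close> gives boundedness of the family.\<close>
    have x_le: "x k \<le> N / (2 * l + 1)" if "k \<in> half_nats" "l \<in> half_nats" "l \<le> k" for k l
      unfolding x_def using frac_le[OF N trace_le[OF that(1)], of "2 * l + 1" "2 * k + 1"]
        that nonneg[of l] by simp
    have x0: "0 \<le> x k" if "k \<in> half_nats" for k using nonneg[OF that] by (simp add: x_def)
    have zero: "0 \<in> half_nats" by (auto simp: half_nats_def intro!: image_eqI[of _ _ 0])
    have bdd: "bdd_above (x ` half_nats)"
      using x_le[OF _ zero] nonneg by (intro bdd_aboveI[of _ N]) auto
    have sup: "fourier_tail_sup \<mu> t f l = (SUP k\<in>{k\<in>half_nats. l \<le> k}. x k)" for l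
      by (simp add: fourier_tail_sup_def x_def)
    have sup_le: "fourier_tail_sup \<mu> t f l \<le> N / (2 * l + 1)" if "l \<in> half_nats" for l
      unfolding sup using that x_le by (intro cSUP_least) auto
    \<comment> \<open>Nonnegativity is needed for monotonicity of \<open>powr\<close> below. The
      supremum dominates its own entry at \<open>k = l\<close>, by boundedness of the
      family.\<close>
    have sup0: "0 \<le> fourier_tail_sup \<mu> t f l" if "l \<in> half_nats" for l
    proof -
      have "x l \<le> fourier_tail_sup \<mu> t f l"
        unfolding sup using that by (intro cSUP_upper bdd_above_mono[OF bdd]) auto
      thus ?thesis using x0[OF that] by linarith
    qed
    have term_le: "(2 * l + 1) powr (p - 2) * fourier_tail_sup \<mu> t f l powr p \<le> N powr p * w l"
      if l: "l \<in> half_nats" for l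
    proof -
      have pos: "2 * l + 1 > 0" using nonneg[OF l] by simp
      have "fourier_tail_sup \<mu> t f l powr p \<le> (N / (2 * l + 1)) powr p"
        using sup0 sup_le l assms by (intro powr_mono2) auto
      hence "(2 * l + 1) powr (p - 2) * fourier_tail_sup \<mu> t f l powr p
          \<le> (2 * l + 1) powr (p - 2) * (N / (2 * l + 1)) powr p"
        by (intro mult_left_mono) auto
      also have "\<dots> = N powr p * w l"
        using pos N by (simp add: w_def powr_divide powr_diff powr_numeral)
      finally show ?thesis .
    qed
    have Nw: "(\<lambda>l. N powr p * w l) summable_on half_nats"
      by (intro summable_on_cmult_right w)
    have summ: "(\<lambda>l. (2 * l + 1) powr (p - 2) * fourier_tail_sup \<mu> t f l powr p) summable_on half_nats"
      by (rule summable_on_comparison_test[OF Nw]) (auto simp: term_le)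
    have "(\<Sum>\<^sub>\<infinity>l\<in>half_nats. (2 * l + 1) powr (p - 2) * fourier_tail_sup \<mu> t f l powr p)
        \<le> (\<Sum>\<^sub>\<infinity>l\<in>half_nats. N powr p * w l)"
      by (rule infsum_mono[OF summ Nw term_le])
    also have "\<dots> = N powr p * infsum w half_nats" by (simp add: infsum_cmult_right')
    also have "\<dots> \<le> N powr p * (infsum w half_nats + 1)" by (intro mult_left_mono) auto
    also have "\<dots> = c * Lp_norm p \<mu> f powr p"
    proof -
      have "N powr p = (3 / 2) powr p * Lp_norm p \<mu> f powr p"
        unfolding N_def by (rule powr_mult; simp add: Lp_norm_def)
      thus ?thesis by (simp add: c_def)
    qed
    finally show ?thesis using bdd summ by (simp add: x_def)
  qed
  have "c > 0" using w0 by (simp add: c_def)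
  with main show ?thesis by blast
qed

end
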